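(* Let $m$ be a positive integer, let $\rho:(0,\infty)\to\mathbb{R}$ be a continuous right admissible weighted function, and let $\{S(t)\}_{t\ge0}$ be the right translation $C_0$-semigroup on $L^2(\mathbb{R}^+,\rho)$. Then $S(t)$ is an $m$-isometry for every $t>0$ if and only if $\rho(s)$ is a polynomial of degree less than $m$.
   Context: A right admissible weighted function is a measurable function $\rho:(0,\infty)\to\mathbb{R}$ with $\rho(\tau)>0$ for all $\tau\in(0,\infty)$ and such that there are constants $M\ge1$, $\omega\in\mathbb{R}$ with $\rho(t+\tau)\le Me^{\omega t}\rho(\tau)$ for all $\tau\in(0,\infty)$ and $t>0$. $L^2(\mathbb{R}^+,\rho)$ is the space of (classes of) measurable functions $f:\mathbb{R}^+\to\mathbb{C}$ with $\|f\|^2=\int_0^\infty|f(s)|^2\rho(s)\,ds<\infty$. The right translation semigroup is given by $(S(t)f)(s)=0$ if $s\le t$ and $(S(t)f)(s)=f(s-t)$ if $s>t$; it is a $C_0$-semigroup (a strongly continuous semigroup of bounded operators) on $L^2(\mathbb{R}^+,\rho)$. A bounded operator $T$ on a Hilbert space is an $m$-isometry if $\sum_{k=0}^m\binom{m}{k}(-1)^{m-k}\|T^kx\|^2=0$ for all vectors $x$. *)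

theory Defs
  imports "HOL-Analysis.Analysis" "HOL-Computational_Algebra.Polynomial"
begin

text \<open>
  Functions on the open half-line are modelled as functions on all of \<^typ>\<open>real\<close> whose values
  on \<open>{..0}\<close> are irrelevant: every notion below only looks at the restriction to \<open>{0<..}\<close>.
\<close>

abbreviation halfline :: "real measure" where
  "halfline \<equiv> lebesgue_on {0<..}"

definition right_admissible :: "(real \<Rightarrow> real) \<Rightarrow> bool" where
  "right_admissible \<rho> \<longleftrightarrow>
     \<rho> \<in> borel_measurable halfline \<and>
     (\<forall>\<tau>>0. \<rho> \<tau> > 0) \<and>
     (\<exists>M \<omega>. M \<ge> 1 \<and> (\<forall>\<tau>>0. \<forall>t>0. \<rho> (t + \<tau>) \<le> M * exp (\<omega> * t) * \<rho> \<tau>))"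


subsection \<open>The weighted space\<close>

definition L2_fun :: "(real \<Rightarrow> real) \<Rightarrow> (real \<Rightarrow> complex) set" where
  "L2_fun \<rho> = {f \<in> borel_measurable halfline. integrable halfline (\<lambda>s. (cmod (f s))\<^sup>2 * \<rho> s)}"

definition L2_eq :: "(real \<Rightarrow> real) \<Rightarrow> ((real \<Rightarrow> complex) \<times> (real \<Rightarrow> complex)) set" where
  "L2_eq \<rho> = {(f, g). f \<in> L2_fun \<rho> \<and> g \<in> L2_fun \<rho> \<and> (AE s in halfline. f s = g s)}"

definition L2_class :: "(real \<Rightarrow> real) \<Rightarrow> (real \<Rightarrow> complex) \<Rightarrow> (real \<Rightarrow> complex) set" where
  "L2_class \<rho> f = L2_eq \<rho> `` {f}"

definition L2_space :: "(real \<Rightarrow> real) \<Rightarrow> (real \<Rightarrow> complex) set set" where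
  "L2_space \<rho> = L2_fun \<rho> // L2_eq \<rho>"

text \<open>
  The operations on classes are those of an arbitrary representative; the lemmas
  \<open>L2_norm_class\<close>, \<open>L2_add_class\<close>, \<open>L2_scale_class\<close> and \<open>right_translation_class\<close> below show
  independence of the choice.
\<close>

definition L2_rep :: "(real \<Rightarrow> complex) set \<Rightarrow> (real \<Rightarrow> complex)" where
  "L2_rep X = (SOME f. f \<in> X)"

definition L2_norm :: "(real \<Rightarrow> real) \<Rightarrow> (real \<Rightarrow> complex) set \<Rightarrow> real" where
  "L2_norm \<rho> X = sqrt (LINT s|halfline. (cmod (L2_rep X s))\<^sup>2 * \<rho> s)"

definition L2_add :: "(real \<Rightarrow> real) \<Rightarrow> (real \<Rightarrow> complex) set \<Rightarrow> (real \<Rightarrow> complex) set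
    \<Rightarrow> (real \<Rightarrow> complex) set" where
  "L2_add \<rho> X Y = L2_class \<rho> (\<lambda>s. L2_rep X s + L2_rep Y s)"

definition L2_scale :: "(real \<Rightarrow> real) \<Rightarrow> complex \<Rightarrow> (real \<Rightarrow> complex) set
    \<Rightarrow> (real \<Rightarrow> complex) set" where
  "L2_scale \<rho> c X = L2_class \<rho> (\<lambda>s. c * L2_rep X s)"


subsection \<open>Operators\<close>

definition L2_bounded_operator ::
    "(real \<Rightarrow> real) \<Rightarrow> ((real \<Rightarrow> complex) set \<Rightarrow> (real \<Rightarrow> complex) set) \<Rightarrow> bool" where
  "L2_bounded_operator \<rho> T \<longleftrightarrow>
     (\<forall>X\<in>L2_space \<rho>. T X \<in> L2_space \<rho>) \<and>
     (\<forall>X\<in>L2_space \<rho>. \<forall>Y\<in>L2_space \<rho>. T (L2_add \<rho> X Y) = L2_add \<rho> (T X) (T Y)) \<and>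
     (\<forall>c. \<forall>X\<in>L2_space \<rho>. T (L2_scale \<rho> c X) = L2_scale \<rho> c (T X)) \<and>
     (\<exists>C. \<forall>X\<in>L2_space \<rho>. L2_norm \<rho> (T X) \<le> C * L2_norm \<rho> X)"

definition L2_m_isometry ::
    "(real \<Rightarrow> real) \<Rightarrow> nat \<Rightarrow> ((real \<Rightarrow> complex) set \<Rightarrow> (real \<Rightarrow> complex) set) \<Rightarrow> bool" where
  "L2_m_isometry \<rho> m T \<longleftrightarrow>
     L2_bounded_operator \<rho> T \<and>
     (\<forall>X\<in>L2_space \<rho>.
        (\<Sum>k=0..m. real (m choose k) * (-1) ^ (m - k) * (L2_norm \<rho> ((T ^^ k) X))\<^sup>2) = 0)"

definition shift_fun :: "real \<Rightarrow> (real \<Rightarrow> complex) \<Rightarrow> real \<Rightarrow> complex" where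
  "shift_fun t f s = (if s \<le> t then 0 else f (s - t))"

definition right_translation ::
    "(real \<Rightarrow> real) \<Rightarrow> real \<Rightarrow> (real \<Rightarrow> complex) set \<Rightarrow> (real \<Rightarrow> complex) set" where
  "right_translation \<rho> t X = L2_class \<rho> (shift_fun t (L2_rep X))"


subsection \<open>Independence of representatives\<close>

lemma equiv_L2_eq: "equiv (L2_fun \<rho>) (L2_eq \<rho>)"
proof (rule equivI)
  show "L2_eq \<rho> \<subseteq> L2_fun \<rho> \<times> L2_fun \<rho>" by (auto simp: L2_eq_def)
  show "refl_on (L2_fun \<rho>) (L2_eq \<rho>)" by (auto simp: refl_on_def L2_eq_def)
  show "sym (L2_eq \<rho>)" by (auto simp: sym_def L2_eq_def eq_commute)
  show "trans (L2_eq \<rho>)"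
  proof (rule transI)
    fix f g h assume "(f, g) \<in> L2_eq \<rho>" "(g, h) \<in> L2_eq \<rho>"
    then show "(f, h) \<in> L2_eq \<rho>" unfolding L2_eq_def by (auto elim: eventually_elim2)
  qed
qed

lemma L2_class_in_space: "f \<in> L2_fun \<rho> \<Longrightarrow> L2_class \<rho> f \<in> L2_space \<rho>"
  by (auto simp: L2_class_def L2_space_def quotient_def)

lemma L2_spaceE:
  assumes "X \<in> L2_space \<rho>"
  obtains f where "f \<in> L2_fun \<rho>" "X = L2_class \<rho> f"
  using assms by (auto simp: L2_class_def L2_space_def quotient_def)

lemma L2_class_eq:
  assumes "f \<in> L2_fun \<rho>" "g \<in> L2_fun \<rho>" "AE s in halfline. f s = g s"
  shows "L2_class \<rho> f = L2_class \<rho> g"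
  unfolding L2_class_def by (rule equiv_class_eq[OF equiv_L2_eq]) (use assms in \<open>simp add: L2_eq_def\<close>)

lemma L2_rep_class:
  assumes "f \<in> L2_fun \<rho>"
  shows "L2_rep (L2_class \<rho> f) \<in> L2_fun \<rho>" "AE s in halfline. f s = L2_rep (L2_class \<rho> f) s"
proof -
  have "f \<in> L2_class \<rho> f" using assms by (auto simp: L2_class_def L2_eq_def)
  then have "L2_rep (L2_class \<rho> f) \<in> L2_class \<rho> f"
    unfolding L2_rep_def by (rule someI[where P = "\<lambda>g. g \<in> L2_class \<rho> f"])
  then show "L2_rep (L2_class \<rho> f) \<in> L2_fun \<rho>" "AE s in halfline. f s = L2_rep (L2_class \<rho> f) s"
    by (auto simp: L2_class_def L2_eq_def)
qed

lemma L2_rep_in_fun: "X \<in> L2_space \<rho> \<Longrightarrow> L2_rep X \<in> L2_fun \<rho>"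
  by (metis L2_spaceE L2_rep_class(1))

lemma L2_class_rep: "X \<in> L2_space \<rho> \<Longrightarrow> L2_class \<rho> (L2_rep X) = X"
  by (metis L2_spaceE L2_rep_class L2_class_eq)

lemma L2_norm_class:
  assumes "right_admissible \<rho>" "f \<in> L2_fun \<rho>"
  shows "L2_norm \<rho> (L2_class \<rho> f) = sqrt (LINT s|halfline. (cmod (f s))\<^sup>2 * \<rho> s)"
proof -
  have [measurable]: "\<rho> \<in> borel_measurable halfline" "f \<in> borel_measurable halfline"
    "L2_rep (L2_class \<rho> f) \<in> borel_measurable halfline"
    using assms L2_rep_class(1)[OF assms(2)] by (auto simp: right_admissible_def L2_fun_def)
  have "(LINT s|halfline. (cmod (f s))\<^sup>2 * \<rho> s)
      = (LINT s|halfline. (cmod (L2_rep (L2_class \<rho> f) s))\<^sup>2 * \<rho> s)"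
    by (rule integral_cong_AE) (use L2_rep_class(2)[OF assms(2)] in \<open>auto elim: eventually_mono\<close>)
  then show ?thesis by (simp add: L2_norm_def)
qed

lemma L2_fun_add:
  assumes "right_admissible \<rho>" "f \<in> L2_fun \<rho>" "g \<in> L2_fun \<rho>"
  shows "(\<lambda>s. f s + g s) \<in> L2_fun \<rho>"
proof -
  have [measurable]: "\<rho> \<in> borel_measurable halfline" "f \<in> borel_measurable halfline"
    "g \<in> borel_measurable halfline"
    using assms by (auto simp: right_admissible_def L2_fun_def)
  have "integrable halfline (\<lambda>s. (cmod (f s + g s))\<^sup>2 * \<rho> s)"
  proof (rule Bochner_Integration.integrable_bound)
    show "integrable halfline (\<lambda>s. 2 * ((cmod (f s))\<^sup>2 * \<rho> s) + 2 * ((cmod (g s))\<^sup>2 * \<rho> s))"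
      using assms by (auto simp: L2_fun_def)
    have "norm ((cmod (f s + g s))\<^sup>2 * \<rho> s)
        \<le> norm (2 * ((cmod (f s))\<^sup>2 * \<rho> s) + 2 * ((cmod (g s))\<^sup>2 * \<rho> s))" if "s > 0" for s
    proof -
      have "\<rho> s > 0" using assms that by (auto simp: right_admissible_def)
      have "(cmod (f s + g s))\<^sup>2 \<le> (cmod (f s) + cmod (g s))\<^sup>2"
        by (intro power_mono norm_triangle_ineq) auto
      also have "\<dots> \<le> 2 * (cmod (f s))\<^sup>2 + 2 * (cmod (g s))\<^sup>2"
        using sum_squares_bound[of "cmod (f s)" "cmod (g s)"] by (simp add: power2_sum)
      finally have "(cmod (f s + g s))\<^sup>2 * \<rho> s \<le> (2 * (cmod (f s))\<^sup>2 + 2 * (cmod (g s))\<^sup>2) * \<rho> s"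
        using \<open>\<rho> s > 0\<close> by (intro mult_right_mono) auto
      then show ?thesis using \<open>\<rho> s > 0\<close> by (simp add: algebra_simps)
    qed
    then show "AE s in halfline. norm ((cmod (f s + g s))\<^sup>2 * \<rho> s)
        \<le> norm (2 * ((cmod (f s))\<^sup>2 * \<rho> s) + 2 * ((cmod (g s))\<^sup>2 * \<rho> s))"
      by (intro AE_I2) (auto simp: space_restrict_space)
  qed measurable
  then show ?thesis by (simp add: L2_fun_def)
qed

lemma L2_fun_scale: "f \<in> L2_fun \<rho> \<Longrightarrow> (\<lambda>s. c * f s) \<in> L2_fun \<rho>"
  by (auto simp: L2_fun_def norm_mult power_mult_distrib mult.assoc)

lemma L2_add_class:
  assumes "right_admissible \<rho>" "f \<in> L2_fun \<rho>" "g \<in> L2_fun \<rho>"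
  shows "L2_add \<rho> (L2_class \<rho> f) (L2_class \<rho> g) = L2_class \<rho> (\<lambda>s. f s + g s)"
  unfolding L2_add_def
proof (rule L2_class_eq)
  show "AE s in halfline. L2_rep (L2_class \<rho> f) s + L2_rep (L2_class \<rho> g) s = f s + g s"
    using L2_rep_class(2)[OF assms(2)] L2_rep_class(2)[OF assms(3)] by eventually_elim simp
qed (use assms L2_rep_class in \<open>auto intro!: L2_fun_add\<close>)

lemma L2_scale_class:
  assumes "f \<in> L2_fun \<rho>"
  shows "L2_scale \<rho> c (L2_class \<rho> f) = L2_class \<rho> (\<lambda>s. c * f s)"
  unfolding L2_scale_def
proof (rule L2_class_eq)
  show "AE s in halfline. c * L2_rep (L2_class \<rho> f) s = c * f s"
    using L2_rep_class(2)[OF assms(1)] by eventually_elim simp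
qed (use assms L2_rep_class in \<open>auto intro!: L2_fun_scale\<close>)

lemma halfline_measurable_iff:
  fixes f :: "real \<Rightarrow> 'a :: real_normed_vector"
  shows "f \<in> borel_measurable halfline
    \<longleftrightarrow> (\<lambda>s. indicat_real {0<..} s *\<^sub>R f s) \<in> borel_measurable lebesgue"
  by (subst borel_measurable_restrict_space_iff) simp_all

lemma measurable_minus_lebesgue: "(\<lambda>s::real. s - t) \<in> lebesgue \<rightarrow>\<^sub>M lebesgue"
  using lebesgue_affine_measurable[where c = "\<lambda>_::real. 1" and t = "- t"] by simp

lemma AE_halfline_iff: "(AE s in halfline. P s) \<longleftrightarrow> (AE s in lebesgue. 0 < s \<longrightarrow> P s)"
  by (subst AE_restrict_space_iff) auto

lemma AE_lebesgue_minus: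
  assumes "AE s in lebesgue. P s"
  shows "AE s in lebesgue. P (s - t :: real)"
proof -
  have "lebesgue = density (distr lebesgue lebesgue (\<lambda>s. - t + 1 * s)) (\<lambda>_. ennreal \<bar>1\<bar>)"
    by (rule lebesgue_real_affine) simp
  then have "lebesgue = distr lebesgue lebesgue (\<lambda>s. s - t)"
    by (simp add: density_1)
  then have "AE s in distr lebesgue lebesgue (\<lambda>s. s - t). P s"
    using assms by metis
  then show ?thesis by (rule AE_distrD[OF measurable_minus_lebesgue])
qed

lemma shift_fun_AE_cong:
  assumes "AE s in halfline. f s = g s"
  shows "AE s in halfline. shift_fun t f s = shift_fun t g s"
  using AE_lebesgue_minus[of _ t, OF assms[unfolded AE_halfline_iff]]
  unfolding AE_halfline_iff by eventually_elim (auto simp: shift_fun_def)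

lemma shift_fun_L2:
  assumes "right_admissible \<rho>" "f \<in> L2_fun \<rho>" "t \<ge> 0"
  shows "shift_fun t f \<in> L2_fun \<rho>"
    and "(LINT s|halfline. (cmod (shift_fun t f s))\<^sup>2 * \<rho> s)
      = (LINT s|halfline. (cmod (f s))\<^sup>2 * \<rho> (s + t))"
    and "integrable halfline (\<lambda>s. (cmod (f s))\<^sup>2 * \<rho> (s + t))"
proof -
  let ?I = "\<lambda>s. indicat_real {0<..} s"
  have rho [measurable]: "\<rho> \<in> borel_measurable halfline" and f [measurable]: "f \<in> borel_measurable halfline"
    and pos: "\<And>s. s > 0 \<Longrightarrow> \<rho> s > 0"
    using assms by (auto simp: right_admissible_def L2_fun_def)
  obtain M w where M: "M \<ge> 1" and Mw: "\<And>u v. u > 0 \<Longrightarrow> v > 0 \<Longrightarrow> \<rho> (v + u) \<le> M * exp (w * v) * \<rho> u"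
    using assms(1) unfolding right_admissible_def by blast
  have bnd: "\<rho> (s + t) \<le> M * exp (w * t) * \<rho> s" if "s > 0" for s
  proof (cases "t = 0")
    case True
    then show ?thesis using M pos[OF that] by simp
  next
    case False
    then show ?thesis using Mw[OF that, of t] assms(3) by (simp add: add.commute)
  qed
  have eqf: "(\<lambda>s. ?I s *\<^sub>R shift_fun t f s) = (\<lambda>s. (\<lambda>x. ?I x *\<^sub>R f x) (s - t))"
    using assms(3) by (auto simp: shift_fun_def fun_eq_iff indicator_def)
  have sm [measurable]: "shift_fun t f \<in> borel_measurable halfline"
    unfolding halfline_measurable_iff eqf
    by (rule measurable_compose[OF measurable_minus_lebesgue])
      (use f in \<open>simp add: halfline_measurable_iff\<close>)
  have mr: "(\<lambda>s. \<rho> (s + t)) \<in> borel_measurable halfline"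
  proof -
    have "(\<lambda>s. ?I (s + t) *\<^sub>R \<rho> (s + t)) \<in> borel_measurable lebesgue"
      using measurable_compose[OF measurable_minus_lebesgue[of "- t"] rho[unfolded halfline_measurable_iff]]
      by simp
    then have "(\<lambda>s. ?I s *\<^sub>R (?I (s + t) *\<^sub>R \<rho> (s + t))) \<in> borel_measurable lebesgue"
      by (rule borel_measurable_scaleR[OF borel_measurable_indicator, rotated]) simp
    also have "(\<lambda>s. ?I s *\<^sub>R (?I (s + t) *\<^sub>R \<rho> (s + t))) = (\<lambda>s. ?I s *\<^sub>R \<rho> (s + t))"
      using assms(3) by (auto simp: fun_eq_iff indicator_def)
    finally show ?thesis by (simp add: halfline_measurable_iff)
  qed
  note [measurable] = mr
  show int: "integrable halfline (\<lambda>s. (cmod (f s))\<^sup>2 * \<rho> (s + t))"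
  proof (rule Bochner_Integration.integrable_bound)
    show "integrable halfline (\<lambda>s. M * exp (w * t) * ((cmod (f s))\<^sup>2 * \<rho> s))"
      using assms(2) by (auto simp: L2_fun_def)
    have "norm ((cmod (f s))\<^sup>2 * \<rho> (s + t)) \<le> norm (M * exp (w * t) * ((cmod (f s))\<^sup>2 * \<rho> s))"
      if "s > 0" for s
    proof -
      have "(cmod (f s))\<^sup>2 * \<rho> (s + t) \<le> (cmod (f s))\<^sup>2 * (M * exp (w * t) * \<rho> s)"
        by (intro mult_left_mono bnd that) auto
      then show ?thesis
        using pos[OF that] pos[of "s + t"] that assms(3) M by (simp add: abs_mult mult_ac)
    qed
    then show "AE s in halfline. norm ((cmod (f s))\<^sup>2 * \<rho> (s + t))
        \<le> norm (M * exp (w * t) * ((cmod (f s))\<^sup>2 * \<rho> s))"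
      by (intro AE_I2) (auto simp: space_restrict_space)
  qed measurable
  let ?G = "\<lambda>s. ?I s *\<^sub>R ((cmod (f s))\<^sup>2 * \<rho> (s + t))"
  have eqG: "(\<lambda>s. ?I s *\<^sub>R ((cmod (shift_fun t f s))\<^sup>2 * \<rho> s)) = (\<lambda>s. ?G (- t + 1 * s))"
    using assms(3) by (auto simp: shift_fun_def fun_eq_iff indicator_def)
  have "integrable lebesgue ?G"
    using int by (simp add: integrable_restrict_space)
  then have hb: "has_bochner_integral lebesgue ?G (integral\<^sup>L lebesgue ?G)"
    by (simp add: has_bochner_integral_iff)
  then have "has_bochner_integral lebesgue (\<lambda>s. ?G (- t + 1 * s)) (integral\<^sup>L lebesgue ?G)"
    using has_bochner_integral_lebesgue_real_affine_iff[of 1 ?G "integral\<^sup>L lebesgue ?G" "- t"] by simp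
  then have hb': "integrable lebesgue (\<lambda>s. ?I s *\<^sub>R ((cmod (shift_fun t f s))\<^sup>2 * \<rho> s))"
    "(LINT s|lebesgue. ?I s *\<^sub>R ((cmod (shift_fun t f s))\<^sup>2 * \<rho> s)) = integral\<^sup>L lebesgue ?G"
    unfolding eqG has_bochner_integral_iff by auto
  show "shift_fun t f \<in> L2_fun \<rho>"
    using hb'(1) sm by (simp add: L2_fun_def integrable_restrict_space)
  show "(LINT s|halfline. (cmod (shift_fun t f s))\<^sup>2 * \<rho> s)
      = (LINT s|halfline. (cmod (f s))\<^sup>2 * \<rho> (s + t))"
    using hb'(2) by (simp add: integral_restrict_space)
qed

lemma right_translation_class:
  assumes "right_admissible \<rho>" "f \<in> L2_fun \<rho>" "t \<ge> 0"
  shows "right_translation \<rho> t (L2_class \<rho> f) = L2_class \<rho> (shift_fun t f)"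
  unfolding right_translation_def
proof (rule L2_class_eq)
  show "AE s in halfline. shift_fun t (L2_rep (L2_class \<rho> f)) s = shift_fun t f s"
    by (rule shift_fun_AE_cong) (use L2_rep_class(2)[OF assms(2)] in \<open>auto elim: eventually_mono\<close>)
qed (use assms L2_rep_class in \<open>auto intro!: shift_fun_L2(1)\<close>)

lemma right_translation_add:
  assumes "right_admissible \<rho>" "X \<in> L2_space \<rho>" "s \<ge> 0" "t \<ge> 0"
  shows "right_translation \<rho> (s + t) X = right_translation \<rho> s (right_translation \<rho> t X)"
proof -
  obtain f where f: "f \<in> L2_fun \<rho>" "X = L2_class \<rho> f" using assms(2) by (rule L2_spaceE)
  have "shift_fun s (shift_fun t f) = shift_fun (s + t) f"
    using assms by (auto simp: shift_fun_def fun_eq_iff algebra_simps)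
  then show ?thesis
    using assms f by (simp add: right_translation_class shift_fun_L2(1))
qed

lemma right_translation_0:
  assumes "right_admissible \<rho>" "X \<in> L2_space \<rho>"
  shows "right_translation \<rho> 0 X = X"
proof -
  obtain f where f: "f \<in> L2_fun \<rho>" "X = L2_class \<rho> f" using assms(2) by (rule L2_spaceE)
  have "L2_class \<rho> (shift_fun 0 f) = L2_class \<rho> f"
    by (rule L2_class_eq)
      (use assms f in \<open>auto simp: shift_fun_def space_restrict_space intro!: shift_fun_L2(1) AE_I2\<close>)
  then show ?thesis using assms f by (simp add: right_translation_class)
qed

lemma right_translation_bounded_operator:
  assumes adm: "right_admissible \<rho>" and t: "t \<ge> 0"
  shows "L2_bounded_operator \<rho> (right_translation \<rho> t)"
  unfolding L2_bounded_operator_def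
proof (intro conjI ballI allI)
  fix X assume "X \<in> L2_space \<rho>"
  then obtain f where f: "f \<in> L2_fun \<rho>" "X = L2_class \<rho> f" by (rule L2_spaceE)
  then show "right_translation \<rho> t X \<in> L2_space \<rho>"
    using adm t by (simp add: right_translation_class L2_class_in_space shift_fun_L2(1))
  have "shift_fun t (\<lambda>s. c * f s) = (\<lambda>s. c * shift_fun t f s)" for c
    by (auto simp: shift_fun_def)
  then show "right_translation \<rho> t (L2_scale \<rho> c X) = L2_scale \<rho> c (right_translation \<rho> t X)" for c
    using adm t f by (simp add: right_translation_class L2_scale_class shift_fun_L2(1) L2_fun_scale)
  fix Y assume "Y \<in> L2_space \<rho>"
  then obtain g where g: "g \<in> L2_fun \<rho>" "Y = L2_class \<rho> g" by (rule L2_spaceE)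
  have "shift_fun t (\<lambda>s. f s + g s) = (\<lambda>s. shift_fun t f s + shift_fun t g s)"
    by (auto simp: shift_fun_def)
  then show "right_translation \<rho> t (L2_add \<rho> X Y)
      = L2_add \<rho> (right_translation \<rho> t X) (right_translation \<rho> t Y)"
    using adm t f g by (simp add: right_translation_class L2_add_class shift_fun_L2(1) L2_fun_add)
next
  have pos: "\<And>s. s > 0 \<Longrightarrow> \<rho> s > 0"
    using adm by (auto simp: right_admissible_def)
  obtain M w where M: "M \<ge> 1" and Mw: "\<And>u v. u > 0 \<Longrightarrow> v > 0 \<Longrightarrow> \<rho> (v + u) \<le> M * exp (w * v) * \<rho> u"
    using adm unfolding right_admissible_def by blast
  have bnd: "\<rho> (s + t) \<le> M * exp (w * t) * \<rho> s" if "s > 0" for s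
  proof (cases "t = 0")
    case True
    then show ?thesis using M pos[OF that] by simp
  next
    case False
    then show ?thesis using Mw[OF that, of t] t by (simp add: add.commute)
  qed
  have "L2_norm \<rho> (right_translation \<rho> t X) \<le> sqrt (M * exp (w * t)) * L2_norm \<rho> X"
    if X: "X \<in> L2_space \<rho>" for X
  proof -
    obtain f where f: "f \<in> L2_fun \<rho>" "X = L2_class \<rho> f" using X by (rule L2_spaceE)
    have "(LINT s|halfline. (cmod (f s))\<^sup>2 * \<rho> (s + t))
        \<le> (LINT s|halfline. M * exp (w * t) * ((cmod (f s))\<^sup>2 * \<rho> s))"
    proof (rule integral_mono)
      show "integrable halfline (\<lambda>s. (cmod (f s))\<^sup>2 * \<rho> (s + t))"
        by (rule shift_fun_L2(3)[OF adm f(1) t])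
      show "integrable halfline (\<lambda>s. M * exp (w * t) * ((cmod (f s))\<^sup>2 * \<rho> s))"
        using f by (auto simp: L2_fun_def)
      fix s assume "s \<in> space halfline"
      then have "s > 0" by (simp add: space_restrict_space)
      have "(cmod (f s))\<^sup>2 * \<rho> (s + t) \<le> (cmod (f s))\<^sup>2 * (M * exp (w * t) * \<rho> s)"
        by (intro mult_left_mono bnd \<open>s > 0\<close>) auto
      then show "(cmod (f s))\<^sup>2 * \<rho> (s + t) \<le> M * exp (w * t) * ((cmod (f s))\<^sup>2 * \<rho> s)"
        by (simp add: mult_ac)
    qed
    also have "\<dots> = M * exp (w * t) * (LINT s|halfline. (cmod (f s))\<^sup>2 * \<rho> s)"
      by simp
    finally show ?thesis
      using adm t f
      by (simp add: right_translation_class L2_norm_class shift_fun_L2(1,2) flip: real_sqrt_mult)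
  qed
  then show "\<exists>C. \<forall>X\<in>L2_space \<rho>. L2_norm \<rho> (right_translation \<rho> t X) \<le> C * L2_norm \<rho> X"
    by blast
qed

end

theory Submission
  imports Defs
begin

text \<open>
  Since \<open>\<parallel>S(t)\<^sup>k f\<parallel>\<^sup>2 = \<integral> \<bar>f(s)\<bar>\<^sup>2 \<rho>(s + k t) ds\<close>, the defect of the \<open>m\<close>-isometry identity at \<open>f\<close> is
  the integral of \<open>\<bar>f\<bar>\<^sup>2\<close> against the \<open>m\<close>-th forward difference of \<open>\<rho>\<close> with step \<open>t\<close>. Differences of
  order \<open>m\<close> kill polynomials of degree less than \<open>m\<close>. Conversely, testing with indicators of short
  intervals shows that all these differences vanish; then \<open>\<rho>\<close> agrees on every lattice
  \<open>{k/n. k \<ge> 1}\<close> with a polynomial of degree less than \<open>m\<close>. As every such lattice contains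
  \<open>1, \<dots>, m\<close>, these polynomials coincide, and \<open>\<rho>\<close> equals the common one on the positive rationals,
  hence everywhere by continuity.
\<close>

section \<open>Forward differences of sequences and polynomials\<close>

definition fdiff :: "nat \<Rightarrow> (nat \<Rightarrow> real) \<Rightarrow> real" where
  "fdiff m g = (\<Sum>k=0..m. real (m choose k) * (-1) ^ (m - k) * g k)"

text \<open>Pascal's rule for \<open>Suc m choose Suc k\<close> gives two sums, and reindexing the
  second produces the unshifted sequence with opposite sign. This form takes the first difference
  before the other \<open>m\<close>, so an induction can replace a polynomial by its
  difference.\<close>

lemma fdiff_Suc: "fdiff (Suc m) g = fdiff m (\<lambda>k. g (Suc k) - g k)"
proof -
  let ?s = "\<lambda>k. (-1) ^ (m - k) :: real"
  have "fdiff (Suc m) g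
      = (-1) ^ Suc m * g 0 + (\<Sum>k=0..m. real (Suc m choose Suc k) * ?s k * g (Suc k))"
    unfolding fdiff_def by (subst sum.atLeast0_atMost_Suc_shift) simp
  also have "(\<Sum>k=0..m. real (Suc m choose Suc k) * ?s k * g (Suc k))
      = (\<Sum>k=0..m. real (m choose k) * ?s k * g (Suc k))
        + (\<Sum>k=0..m. real (m choose Suc k) * ?s k * g (Suc k))"
    by (simp add: algebra_simps sum.distrib)
  also have "(\<Sum>k=0..m. real (m choose Suc k) * ?s k * g (Suc k))
      = - (\<Sum>k=0..m. real (m choose k) * ?s k * g k) + (-1) ^ m * g 0"
  proof -
    have "(\<Sum>k=0..m. real (m choose k) * ?s k * g k)
        = (\<Sum>k=0..Suc m. real (m choose k) * ?s k * g k)"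
      by simp
    also have "\<dots> = (-1) ^ m * g 0
        + (\<Sum>k=0..m. real (m choose Suc k) * (-1) ^ (m - Suc k) * g (Suc k))"
      by (subst sum.atLeast0_atMost_Suc_shift) simp
    also have "(\<Sum>k=0..m. real (m choose Suc k) * (-1) ^ (m - Suc k) * g (Suc k))
        = (\<Sum>k=0..m. - (real (m choose Suc k) * ?s k * g (Suc k)))"
    proof (rule sum.cong[OF refl])
      fix k assume "k \<in> {0..m}"
      show "real (m choose Suc k) * (-1) ^ (m - Suc k) * g (Suc k)
          = - (real (m choose Suc k) * ?s k * g (Suc k))"
      \<comment> \<open>At \<open>k = m\<close> the truncated exponent \<open>m - Suc k\<close> has
        the wrong parity, but \<open>m choose Suc m = 0\<close> makes both sides vanish.\<close>
      proof (cases "k < m")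
        case True
        then have "m - k = Suc (m - Suc k)" by simp
        then show ?thesis by simp
      qed simp
    qed
    finally show ?thesis by (simp add: sum_negf)
  qed
  finally show ?thesis
    by (simp add: fdiff_def right_diff_distrib sum_subtractf)
qed

text \<open>Translating the argument preserves both degree and leading coefficient, so the top terms
  cancel.\<close>

lemma degree_pcompose_translation_diff:
  fixes p :: "real poly"
  assumes "degree p \<le> Suc n"
  shows "degree (p \<circ>\<^sub>p [:t, 1:] - p) \<le> n"
proof (rule degree_le, intro allI impI)
  fix i assume i: "n < i"
  have d: "degree (p \<circ>\<^sub>p [:t, 1:]) = degree p" by (simp add: degree_pcompose)
  show "coeff (p \<circ>\<^sub>p [:t, 1:] - p) i = 0"
  proof (cases "i = degree p")
    case True
    have "lead_coeff (p \<circ>\<^sub>p [:t, 1:]) = lead_coeff p"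
      by (subst lead_coeff_comp) auto
    then show ?thesis using True d by simp
  next
    case False
    then have "degree p < i" using i assms by linarith
    then show ?thesis using d by (simp add: coeff_eq_0)
  qed
qed

lemma fdiff_poly:
  fixes p :: "real poly"
  assumes "degree p < m"
  shows "fdiff m (\<lambda>k. poly p (a + real k * t)) = 0"
  using assms
proof (induction m arbitrary: p)
  case (Suc m)
  have eq: "poly p (a + real (Suc k) * t) - poly p (a + real k * t)
      = poly (p \<circ>\<^sub>p [:t, 1:] - p) (a + real k * t)" for k
    by (simp add: poly_pcompose algebra_simps)
  show ?case
  proof (cases m)
    \<comment> \<open>Constants are treated apart: their difference is the zero polynomial, whose
      degree \<open>0\<close> is not below \<open>m = 0\<close>, so the induction hypothesis cannot
      be used.\<close>
    case 0
    then obtain c where "p = [:c:]" using Suc.prems degree_eq_zeroE[of p] by auto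
    then show ?thesis by (simp add: fdiff_Suc) (simp add: fdiff_def)
  next
    case (Suc n)
    then have "degree (p \<circ>\<^sub>p [:t, 1:] - p) < m"
      using degree_pcompose_translation_diff[of p n t] \<open>degree p < Suc m\<close> by simp
    then show ?thesis unfolding fdiff_Suc eq by (rule Suc.IH)
  qed
qed simp

text \<open>The last term of an \<open>m\<close>-th difference has coefficient 1, so a vanishing
  difference is a linear recurrence of order \<open>m\<close>, and the first \<open>m\<close> values
  determine the sequence.\<close>

lemma fdiff_zero_unique:
  assumes "\<And>j. fdiff m (\<lambda>k. g (j + k)) = 0" "\<And>j. fdiff m (\<lambda>k. h (j + k)) = 0"
    and "\<And>i. i < m \<Longrightarrow> g i = h i"
  shows "g i = h i"
proof (induction i rule: less_induct)
  case (less i)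
  show ?case
  proof (cases "i < m")
    case False
    then obtain j where j: "i = j + m" by (metis add.commute le_add_diff_inverse not_less)
    have eq: "fdiff m f = (\<Sum>k<m. real (m choose k) * (-1) ^ (m - k) * f k) + f m" for f
      by (simp add: fdiff_def atLeast0AtMost flip: lessThan_Suc_atMost)
    have "(\<Sum>k<m. real (m choose k) * (-1) ^ (m - k) * g (j + k))
        = (\<Sum>k<m. real (m choose k) * (-1) ^ (m - k) * h (j + k))"
      by (rule sum.cong) (use less j in auto)
    then show ?thesis using assms(1,2)[of j] by (simp add: eq j)
  qed (use assms in auto)
qed

section \<open>Interpolation and polynomials on lattices\<close>

lemma poly_interpolation_exists:
  fixes x y :: "nat \<Rightarrow> real"
  assumes "inj_on x {..<m}" "m > 0"
  shows "\<exists>p. degree p < m \<and> (\<forall>i<m. poly p (x i) = y i)"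
  using assms(2,1)
proof (induction m rule: nat_induct_non_zero)
  case 1
  show ?case by (rule exI[of _ "[:y 0:]"]) auto
next
  case (Suc m)
  then obtain p where p: "degree p < m" "\<And>i. i < m \<Longrightarrow> poly p (x i) = y i"
    by (auto simp: lessThan_Suc)
  \<comment> \<open>Newton's scheme: \<open>q\<close> vanishes at the old nodes but not at
    \<open>x m\<close>, so a multiple of it corrects the value there without disturbing the
    others.\<close>
  define q where "q = (\<Prod>i<m. [:- x i, 1:])"
  have q0: "poly q (x i) = 0" if "i < m" for i
    using that by (auto simp: q_def poly_prod)
  have qm: "poly q (x m) \<noteq> 0"
    using Suc.prems by (auto simp: q_def poly_prod inj_on_def lessThan_Suc)
  have dq: "degree q \<le> m"
    unfolding q_def using degree_prod_sum_le[of "{..<m}" "\<lambda>i. [:- x i, 1:]"] by simp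
  define r where "r = p + smult ((y m - poly p (x m)) / poly q (x m)) q"
  have "degree r < Suc m"
    unfolding r_def using p(1) dq
    by (intro degree_add_less) (auto intro: le_less_trans[OF degree_smult_le])
  moreover have "\<forall>i<Suc m. poly r (x i) = y i"
    using p q0 qm by (auto simp: r_def less_Suc_eq)
  ultimately show ?case by blast
qed

lemma poly_eq_of_lattice_values:
  fixes p q :: "real poly"
  assumes "degree p < m" "degree q < m" "\<And>i. i < m \<Longrightarrow> poly p (real (Suc i)) = poly q (real (Suc i))"
  shows "p = q"
proof (rule poly_eqI_degree[where A = "(\<lambda>i. real (Suc i)) ` {..<m}"])
  have "card ((\<lambda>i. real (Suc i)) ` {..<m}) = m"
    by (subst card_image) (auto simp: inj_on_def)
  then show "degree p < card ((\<lambda>i. real (Suc i)) ` {..<m})"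
    "degree q < card ((\<lambda>i. real (Suc i)) ` {..<m})"
    using assms by auto
qed (use assms in auto)

text \<open>Interpolate \<open>\<rho>\<close> at the first \<open>m\<close> lattice points; both
  sequences satisfy the same recurrence, so they agree throughout. Indexing by \<open>Suc i\<close>
  keeps the lattice inside the open half-line.\<close>

lemma fdiff_zero_lattice_poly:
  fixes \<rho> :: "real \<Rightarrow> real"
  assumes "m > 0" "t > 0" "\<And>s. s > 0 \<Longrightarrow> fdiff m (\<lambda>k. \<rho> (s + real k * t)) = 0"
  obtains q where "degree q < m" "\<And>i. \<rho> (real (Suc i) * t) = poly q (real (Suc i) * t)"
proof -
  have "inj_on (\<lambda>i. real (Suc i) * t) {..<m}"
    using assms(2) by (auto simp: inj_on_def)
  from poly_interpolation_exists[OF this assms(1), of "\<lambda>i. \<rho> (real (Suc i) * t)"]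
  obtain q where q: "degree q < m"
    "\<And>i. i < m \<Longrightarrow> poly q (real (Suc i) * t) = \<rho> (real (Suc i) * t)" by auto
  have shift: "real (Suc (j + k)) * t = real (Suc j) * t + real k * t" for j k
    by (simp add: algebra_simps)
  have "\<rho> (real (Suc i) * t) = poly q (real (Suc i) * t)" for i
  proof (rule fdiff_zero_unique[where m = m and g = "\<lambda>i. \<rho> (real (Suc i) * t)"
        and h = "\<lambda>i. poly q (real (Suc i) * t)"])
    show "fdiff m (\<lambda>k. \<rho> (real (Suc (j + k)) * t)) = 0" for j
      unfolding shift using assms(2) by (intro assms(3)) simp
    show "fdiff m (\<lambda>k. poly q (real (Suc (j + k)) * t)) = 0" for j
      unfolding shift by (rule fdiff_poly[OF q(1)])
  qed (use q(2) in simp)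
  with q(1) show ?thesis using that by blast
qed

lemma continuous_fdiff_zero_imp_poly:
  fixes \<rho> :: "real \<Rightarrow> real"
  assumes m: "m > 0" and cont: "continuous_on {0<..} \<rho>"
    and D: "\<And>s t. s > 0 \<Longrightarrow> t > 0 \<Longrightarrow> fdiff m (\<lambda>k. \<rho> (s + real k * t)) = 0"
  shows "\<exists>p. degree p < m \<and> (\<forall>s>0. \<rho> s = poly p s)"
proof -
  obtain p where p: "degree p < m" "\<And>i. \<rho> (real (Suc i)) = poly p (real (Suc i))"
    using fdiff_zero_lattice_poly[OF m zero_less_one D] by (metis mult.right_neutral zero_less_one)
  have lattice: "\<rho> (real (Suc i) / real (Suc n)) = poly p (real (Suc i) / real (Suc n))" for i n
  proof -
    obtain q where q: "degree q < m"
      "\<And>i. \<rho> (real (Suc i) * (1 / real (Suc n))) = poly q (real (Suc i) * (1 / real (Suc n)))"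
      using fdiff_zero_lattice_poly[OF m _ D, of "1 / real (Suc n)"] by auto
    have "p = q"
    proof (rule poly_eq_of_lattice_values[OF p(1) q(1)])
      fix i
      \<comment> \<open>The integer \<open>Suc i\<close> is the point of number
        \<open>Suc i * Suc n\<close> on the lattice of mesh \<open>1 / Suc n\<close>;
        \<open>j\<close> is that number less one, as the lattice is indexed from zero.\<close>
      obtain j where "Suc i * Suc n = Suc j" by auto
      then have "real (Suc i) * real (Suc n) = real (Suc j)" by (metis of_nat_mult)
      then have "real (Suc i) = real (Suc j) * (1 / real (Suc n))"
        by (simp add: field_simps del: of_nat_Suc)
      then show "poly p (real (Suc i)) = poly q (real (Suc i))"
        using p(2)[of i] q(2)[of j] by simp
    qed
    then show ?thesis using q(2)[of i] by simp
  qed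
  have rat: "\<rho> x = poly p x" if "x \<in> {0<..} \<inter> \<rat>" for x
  proof -
    have "x > 0" "x \<in> \<rat>" using that by auto
    then obtain a b :: nat where ab: "b \<noteq> 0" "\<bar>x\<bar> = real a / real b"
      using Rats_abs_nat_div_natE by metis
    then have "x = real a / real b" "a \<noteq> 0" using \<open>x > 0\<close> by (auto intro: gr0I)
    then show ?thesis using ab(1) lattice[of "a - 1" "b - 1"] by simp
  qed
  have "\<rho> s - poly p s = 0" if s: "s > 0" for s
  proof (rule ccontr)
    assume ne: "\<rho> s - poly p s \<noteq> 0"
    have "continuous_on {0<..} (\<lambda>x. \<rho> x - poly p x)"
      by (intro continuous_intros cont)
    then have "((\<lambda>x. \<rho> x - poly p x) \<longlongrightarrow> \<rho> s - poly p s) (at s)"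
      using s by (simp add: continuous_on_eq_continuous_at isCont_def)
    then have "\<forall>\<^sub>F x in at s. \<rho> x - poly p x \<noteq> 0"
      using ne by (rule tendsto_imp_eventually_ne)
    then obtain d where d: "d > 0" "\<And>x. x \<noteq> s \<Longrightarrow> dist x s < d \<Longrightarrow> \<rho> x - poly p x \<noteq> 0"
      by (auto simp: eventually_at)
    \<comment> \<open>Choosing the rational to the right of \<open>s\<close> keeps it positive, so
      \<open>rat\<close> applies.\<close>
    obtain x where x: "x \<in> \<rat>" "s < x" "x < s + d"
      using Rats_dense_in_real[of s "s + d"] d(1) by auto
    then show False using rat[of x] d(2)[of x] s by (auto simp: dist_real_def)
  qed
  then show ?thesis using p(1) by auto
qed

section \<open>The isometry defect as an integral\<close>

lemma funpow_right_translation_class: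
  assumes "right_admissible \<rho>" "f \<in> L2_fun \<rho>" "t \<ge> 0"
  shows "(right_translation \<rho> t ^^ k) (L2_class \<rho> f) = L2_class \<rho> (shift_fun (real k * t) f)"
proof (induction k)
  case 0
  \<comment> \<open>\<open>shift_fun 0 f\<close> is zero on the nonpositive reals and so may differ
    from \<open>f\<close> as a function; the two are equal only as classes.\<close>
  have "right_translation \<rho> 0 (L2_class \<rho> f) = L2_class \<rho> f"
    using assms by (intro right_translation_0 L2_class_in_space)
  then show ?case using assms by (simp add: right_translation_class)
next
  case (Suc k)
  have "(right_translation \<rho> t ^^ Suc k) (L2_class \<rho> f)
      = right_translation \<rho> t (right_translation \<rho> (real k * t) (L2_class \<rho> f))"
    using assms Suc by (simp add: right_translation_class)
  also have "\<dots> = right_translation \<rho> (t + real k * t) (L2_class \<rho> f)"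
    using assms by (intro right_translation_add[symmetric] L2_class_in_space) auto
  finally show ?case using assms by (simp add: right_translation_class algebra_simps)
qed

text \<open>A change of variables moves the translation from \<open>f\<close> to the weight;
  linearity of the integral then collects the shifted weights into a difference.\<close>

lemma m_isometry_defect:
  assumes "right_admissible \<rho>" "f \<in> L2_fun \<rho>" "t \<ge> 0"
  shows "(\<Sum>k=0..m. real (m choose k) * (-1) ^ (m - k)
        * (L2_norm \<rho> ((right_translation \<rho> t ^^ k) (L2_class \<rho> f)))\<^sup>2)
      = (LINT s|halfline. (cmod (f s))\<^sup>2 * fdiff m (\<lambda>k. \<rho> (s + real k * t)))" (is "?L = ?R")
    and "integrable halfline (\<lambda>s. (cmod (f s))\<^sup>2 * fdiff m (\<lambda>k. \<rho> (s + real k * t)))"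
proof -
  have pos: "\<rho> s > 0" if "s > 0" for s using assms that by (auto simp: right_admissible_def)
  have int: "integrable halfline (\<lambda>s. (cmod (f s))\<^sup>2 * \<rho> (s + real k * t))" for k
    using assms by (intro shift_fun_L2(3)) auto
  have norm: "(L2_norm \<rho> ((right_translation \<rho> t ^^ k) (L2_class \<rho> f)))\<^sup>2
      = (LINT s|halfline. (cmod (f s))\<^sup>2 * \<rho> (s + real k * t))" for k
  proof -
    \<comment> \<open>Nonnegativity lets the square cancel the square root in the norm.\<close>
    have "(LINT s|halfline. (cmod (f s))\<^sup>2 * \<rho> (s + real k * t)) \<ge> 0"
      by (rule integral_nonneg_AE, rule AE_I2)
        (use assms(3) in \<open>auto simp: space_restrict_space intro!: mult_nonneg_nonneg less_imp_le[OF pos] add_pos_nonneg\<close>)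
    then show ?thesis
      using assms by (simp add: funpow_right_translation_class L2_norm_class shift_fun_L2(1,2))
  qed
  have eq: "(cmod (f s))\<^sup>2 * fdiff m (\<lambda>k. \<rho> (s + real k * t))
      = (\<Sum>k=0..m. real (m choose k) * (-1) ^ (m - k) * ((cmod (f s))\<^sup>2 * \<rho> (s + real k * t)))" for s
    by (simp add: fdiff_def sum_distrib_left mult_ac)
  show "?L = ?R"
    unfolding norm eq using int by (subst Bochner_Integration.integral_sum) auto
  show "integrable halfline (\<lambda>s. (cmod (f s))\<^sup>2 * fdiff m (\<lambda>k. \<rho> (s + real k * t)))"
    unfolding eq using int by (intro Bochner_Integration.integrable_sum integrable_mult_right) auto
qed

section \<open>Testing with indicators of intervals\<close>

lemma indicator_in_L2_fun:
  assumes "continuous_on {0<..} \<rho>" "0 < a"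
  shows "(\<lambda>s. indicator {a..b} s :: complex) \<in> L2_fun \<rho>"
proof -
  \<comment> \<open>Since \<open>a > 0\<close>, the interval is a compact subset of the open
    half-line; near 0 the weight need not be integrable.\<close>
  have "set_integrable lborel {a..b} \<rho>"
    by (rule borel_integrable_atLeastAtMost', rule continuous_on_subset[OF assms(1)]) (use assms in auto)
  then have "integrable lebesgue (\<lambda>s. indicator {a..b} s *\<^sub>R \<rho> s)"
    by (simp add: set_integrable_def integrable_completion)
  also have "(\<lambda>s. indicator {a..b} s *\<^sub>R \<rho> s)
      = (\<lambda>s. indicator {0<..} s *\<^sub>R ((cmod (indicator {a..b} s))\<^sup>2 * \<rho> s))"
    using assms(2) by (auto simp: fun_eq_iff indicator_def)
  finally have "integrable lebesgue
      (\<lambda>s. indicator {0<..} s *\<^sub>R ((cmod (indicator {a..b} s))\<^sup>2 * \<rho> s))" .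
  moreover have "(\<lambda>s. indicator {a..b} s :: complex) \<in> borel_measurable halfline"
    by (intro measurable_restrict_space1 borel_measurable_indicator) simp
  ultimately show ?thesis
    by (simp add: L2_fun_def integrable_restrict_space)
qed

text \<open>Where a continuous function is nonzero, it keeps its sign and stays away from zero on a
  short interval, whose integral then cannot vanish.\<close>

lemma continuous_zero_of_interval_integrals:
  fixes D :: "real \<Rightarrow> real"
  assumes cont: "continuous_on {0<..} D"
    and int: "\<And>a b. 0 < a \<Longrightarrow> integrable halfline (\<lambda>s. indicator {a..b} s * D s)"
    and zero: "\<And>a b. 0 < a \<Longrightarrow> (LINT s|halfline. indicator {a..b} s * D s) = 0"
    and s: "s > 0"
  shows "D s = 0"
proof (rule ccontr)
  assume ne: "D s \<noteq> 0"
  define c where "c = \<bar>D s\<bar> / 2"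
  have c: "c > 0" using ne by (simp add: c_def)
  \<comment> \<open>The factor \<open>sgn (D s)\<close> handles both signs at once.\<close>
  have "((\<lambda>x. sgn (D s) * D x) \<longlongrightarrow> sgn (D s) * D s) (at s)"
    using cont s by (intro tendsto_intros) (auto simp: continuous_on_eq_continuous_at isCont_def)
  moreover have "sgn (D s) * D s > c" using ne by (simp add: c_def mult.commute flip: abs_sgn)
  ultimately have "\<forall>\<^sub>F x in at s. sgn (D s) * D x > c" by (rule order_tendstoD(1))
  then obtain d where d: "d > 0" "\<And>x. x \<noteq> s \<Longrightarrow> dist x s < d \<Longrightarrow> sgn (D s) * D x > c"
    by (auto simp: eventually_at)
  \<comment> \<open>Half of \<open>d\<close> keeps the closed interval inside the open ball, and
    starting at \<open>s\<close> keeps it in the half-line.\<close>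
  define b where "b = s + d / 2"
  have sb: "s < b" using d(1) by (simp add: b_def)
  have ge: "sgn (D s) * D x > c" if "x \<in> {s..b}" for x
    using that d \<open>sgn (D s) * D s > c\<close> by (cases "x = s") (auto simp: b_def dist_real_def)
  have em: "emeasure halfline {s..b} = ennreal (b - s)"
    using s sb by (subst emeasure_restrict_space) auto
  have "0 < c * (b - s)" using c sb by simp
  also have "\<dots> = (LINT x|halfline. c * indicator {s..b} x)"
  proof -
    have "space halfline \<inter> {s..b} = {s..b}" using s by (auto simp: space_restrict_space)
    then show ?thesis using em sb by (simp add: measure_def Int_commute)
  qed
  also have "\<dots> \<le> (LINT x|halfline. sgn (D s) * (indicator {s..b} x * D x))"
  proof (rule integral_mono)
    show "integrable halfline (\<lambda>x. c * indicator {s..b} x)"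
      by (intro integrable_mult_right integrable_real_indicator)
        (use s em in \<open>auto simp: sets_restrict_space_iff\<close>)
    show "integrable halfline (\<lambda>x. sgn (D s) * (indicator {s..b} x * D x))"
      by (intro integrable_mult_right int s)
  qed (use ge in \<open>auto simp: indicator_def less_imp_le\<close>)
  also have "\<dots> = 0" using zero[OF s, of b] by simp
  finally show False by simp
qed

lemma m_isometry_imp_fdiff_zero:
  assumes cont: "continuous_on {0<..} \<rho>" and adm: "right_admissible \<rho>" and t: "t \<ge> 0"
    and iso: "L2_m_isometry \<rho> m (right_translation \<rho> t)" and s: "s > 0"
  shows "fdiff m (\<lambda>k. \<rho> (s + real k * t)) = 0"
proof (rule continuous_zero_of_interval_integrals[OF _ _ _ s])
  have "continuous_on {0<..} (\<lambda>s. \<rho> (s + real k * t))" for k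
    by (rule continuous_on_compose2[OF cont]) (use t in \<open>auto intro!: continuous_intros add_pos_nonneg\<close>)
  then show "continuous_on {0<..} (\<lambda>s. fdiff m (\<lambda>k. \<rho> (s + real k * t)))"
    unfolding fdiff_def by (intro continuous_intros)
  fix a b :: real assume a: "0 < a"
  \<comment> \<open>An indicator equals its squared modulus, so the defect at it is the plain
    integral of the difference over \<open>{a..b}\<close>.\<close>
  have sq: "(cmod (indicator {a..b} x))\<^sup>2 = indicator {a..b} x" for x :: real
    by (simp add: indicator_def)
  note f = indicator_in_L2_fun[OF cont a, of b]
  show "integrable halfline (\<lambda>s. indicator {a..b} s * fdiff m (\<lambda>k. \<rho> (s + real k * t)))"
    using m_isometry_defect(2)[OF adm f t, of m] by (simp add: sq)
  show "(LINT s|halfline. indicator {a..b} s * fdiff m (\<lambda>k. \<rho> (s + real k * t))) = 0"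
    using m_isometry_defect(1)[OF adm f t, of m] iso L2_class_in_space[OF f]
    by (simp add: sq L2_m_isometry_def)
qed

lemma poly_imp_m_isometry:
  assumes adm: "right_admissible \<rho>" and t: "t \<ge> 0"
    and p: "degree p < m" "\<And>s. s > 0 \<Longrightarrow> \<rho> s = poly p s"
  shows "L2_m_isometry \<rho> m (right_translation \<rho> t)"
  unfolding L2_m_isometry_def
proof (intro conjI ballI right_translation_bounded_operator[OF adm t])
  fix X assume "X \<in> L2_space \<rho>"
  then obtain f where f: "f \<in> L2_fun \<rho>" "X = L2_class \<rho> f" by (rule L2_spaceE)
  have "fdiff m (\<lambda>k. \<rho> (s + real k * t)) = 0" if "s > 0" for s
  proof -
    have "\<rho> (s + real k * t) = poly p (s + real k * t)" for k
      using that t by (intro p(2) add_pos_nonneg) auto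
    then show ?thesis using fdiff_poly[OF p(1)] by simp
  qed
  then have "(LINT s|halfline. (cmod (f s))\<^sup>2 * fdiff m (\<lambda>k. \<rho> (s + real k * t)))
      = (LINT s|halfline. 0)"
    by (intro Bochner_Integration.integral_cong) (auto simp: space_restrict_space)
  then show "(\<Sum>k=0..m. real (m choose k) * (-1) ^ (m - k)
      * (L2_norm \<rho> ((right_translation \<rho> t ^^ k) X))\<^sup>2) = 0"
    using m_isometry_defect(1)[OF adm f(1) t, of m] f(2) by simp
qed

theorem theorem4p1:
  fixes m :: nat and \<rho> :: "real \<Rightarrow> real"
  assumes "m > 0"
    and "continuous_on {0<..} \<rho>"
    and "right_admissible \<rho>"
  shows "(\<forall>t>0. L2_m_isometry \<rho> m (right_translation \<rho> t))
    \<longleftrightarrow> (\<exists>p :: real poly. degree p < m \<and> (\<forall>s>0. \<rho> s = poly p s))"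
proof
  assume "\<forall>t>0. L2_m_isometry \<rho> m (right_translation \<rho> t)"
  then show "\<exists>p :: real poly. degree p < m \<and> (\<forall>s>0. \<rho> s = poly p s)"
    using assms by (intro continuous_fdiff_zero_imp_poly m_isometry_imp_fdiff_zero) auto
next
  assume "\<exists>p :: real poly. degree p < m \<and> (\<forall>s>0. \<rho> s = poly p s)"
  then show "\<forall>t>0. L2_m_isometry \<rho> m (right_translation \<rho> t)"
    using assms(3) by (auto intro: poly_imp_m_isometry)
qed

end
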